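(* Let $p_1$ be any mesh pattern, and let $p$ be the mesh pattern obtained from the mesh pattern $(12,\{(0,0),(0,1),(0,2),(1,0),(1,2),(2,0),(2,1),(2,2)\})$ by inserting $p_1$ in the box $(1,1)$. Then $$A_p(x)=F(x)-x^2\big(F(x)-A_{p_1}(x)\big),\qquad F_p(x,q)=(1-x^2)F(x)+x^2F_{p_1}(x,q).$$
   Context: $S_n$ is the set of permutations of $\{1,\dots,n\}$, $n\ge 0$ ($S_0$ consists of the empty permutation). A mesh pattern of length $k$ is a pair $(\tau,R)$ with $\tau\in S_k$ and $R\subseteq\{0,\dots,k\}\times\{0,\dots,k\}$ (the shaded boxes). Given $\pi=\pi_1\cdots\pi_n\in S_n$ and positions $i_1<\dots<i_k$, let $v_1<\dots<v_k$ be the values $\pi_{i_1},\dots,\pi_{i_k}$ sorted increasingly, and put $i_0=v_0=0$, $i_{k+1}=v_{k+1}=n+1$. The box $(r,s)$ contains the elements $\pi_j$ with $i_r<j<i_{r+1}$ and $v_s<\pi_j<v_{s+1}$. The subsequence $\pi_{i_1}\cdots\pi_{i_k}$ is an occurrence of $(\tau,R)$ if it is order-isomorphic to $\tau$ and every box in $R$ contains no element of $\pi$. The empty pattern ($k=0$, $R=\emptyset$) is allowed and has exactly one occurrence in every permutation. Insertion of patterns: if mesh patterns are inserted in some unshaded boxes of a base mesh pattern, an occurrence of the resulting mesh pattern in $\pi$ consists of an occurrence of the base pattern in $\pi$ together with, for each inserted pattern, an occurrence of it in the permutation order-isomorphic to the sequence of all elements of $\pi$ lying in the corresponding box (unshaded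 boxes in which nothing is inserted are unrestricted). For a mesh pattern $p$, $p(\pi)$ is the number of occurrences of $p$ in $\pi$, $F_p(x,q)=\sum_{n\ge0}x^n\sum_{\pi\in S_n}q^{p(\pi)}$, $A_p(x)=\sum_{n\ge 0}x^n\,|\{\pi\in S_n: p(\pi)=0\}|$, and $F(x)=\sum_{n\ge0}n!\,x^n$. All are formal power series. *)

theory Defs
  imports
    "HOL-Computational_Algebra.Polynomial"
    "HOL-Computational_Algebra.Formal_Power_Series"
    "HOL-Combinatorics.Multiset_Permutations"
begin

text \<open>
  Permutations of \<open>{1..n}\<close> are words in one-line notation. Positions are numbered from 1, as in
  \<open>\<pi> = \<pi>\<^sub>1 \<dots> \<pi>\<^sub>n\<close>, so that 0 and \<open>n + 1\<close> are free to serve as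
  the outer grid lines \<open>i\<^sub>0 = v\<^sub>0\<close> and \<open>i\<^sub>k\<^sub>+\<^sub>1 = v\<^sub>k\<^sub>+\<^sub>1\<close>.
\<close>

abbreviation Perms :: "nat \<Rightarrow> nat list set" where
  "Perms n \<equiv> permutations_of_set {1..n}"

definition entry :: "nat list \<Rightarrow> nat \<Rightarrow> nat" where
  "entry \<pi> j = \<pi> ! (j - 1)"

type_synonym mesh = "nat list \<times> (nat \<times> nat) set"

definition mesh_pattern :: "mesh \<Rightarrow> bool" where
  "mesh_pattern p \<longleftrightarrow> fst p \<in> Perms (length (fst p)) \<and>
     snd p \<subseteq> {0..length (fst p)} \<times> {0..length (fst p)}"

definition order_iso :: "nat list \<Rightarrow> nat list \<Rightarrow> bool" where
  "order_iso xs ys \<longleftrightarrow> length xs = length ys \<and>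
     (\<forall>i<length xs. \<forall>j<length xs. xs ! i < xs ! j \<longleftrightarrow> ys ! i < ys ! j)"

text \<open>\<open>grid n [x\<^sub>1, \<dots>, x\<^sub>k] r\<close> is \<open>x\<^sub>r\<close>, with \<open>x\<^sub>0 = 0\<close> and \<open>x\<^sub>k\<^sub>+\<^sub>1 = n + 1\<close>.\<close>

definition grid :: "nat \<Rightarrow> nat list \<Rightarrow> nat \<Rightarrow> nat" where
  "grid n xs r = (0 # xs @ [n + 1]) ! r"

text \<open>
  A choice of positions \<open>i\<^sub>1 < \<dots> < i\<^sub>k\<close> is the strictly increasing list \<open>ps\<close> of them.
  A box is given as the set of positions \<open>j\<close> of the elements \<open>\<pi>\<^sub>j\<close> it contains.
\<close>

definition box :: "nat list \<Rightarrow> nat list \<Rightarrow> nat \<times> nat \<Rightarrow> nat set" where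
  "box \<pi> ps = (\<lambda>(r, s). let n = length \<pi>; vs = sort (map (entry \<pi>) ps) in
     {j \<in> {1..n}. grid n ps r < j \<and> j < grid n ps (r + 1) \<and>
                  grid n vs s < entry \<pi> j \<and> entry \<pi> j < grid n vs (s + 1)})"

definition occurrence :: "mesh \<Rightarrow> nat list \<Rightarrow> nat list \<Rightarrow> bool" where
  "occurrence p \<pi> ps \<longleftrightarrow>
     sorted_wrt (<) ps \<and> set ps \<subseteq> {1..length \<pi>} \<and>
     order_iso (map (entry \<pi>) ps) (fst p) \<and> (\<forall>b \<in> snd p. box \<pi> ps b = {})"

definition occ_count :: "mesh \<Rightarrow> nat list \<Rightarrow> nat" where
  "occ_count p \<pi> = card {ps. occurrence p \<pi> ps}"

text \<open>
  Inserting \<open>(\<tau>, R)\<close>, of length \<open>k\<close>, in the box \<open>(a, b)\<close> of the base pattern \<open>(\<sigma>, S)\<close>.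
  The elements of \<open>\<tau>\<close> subdivide column \<open>a\<close> of the base grid into the columns
  \<open>a, \<dots>, a + k\<close> and row \<open>b\<close> into the rows \<open>b, \<dots>, b + k\<close>; \<open>coarse a k\<close> maps each
  refined column (or row) to the base column (or row) it came from.
  The construction is meant for an unshaded box, \<open>(a, b) \<notin> S\<close>; see \<open>occurrence_insert_mesh\<close>
  below for what the occurrences of the result are.
\<close>

definition coarse :: "nat \<Rightarrow> nat \<Rightarrow> nat \<Rightarrow> nat" where
  "coarse a k c = (if c < a then c else if c \<le> a + k then a else c - k)"

definition insert_mesh :: "mesh \<Rightarrow> nat \<times> nat \<Rightarrow> mesh \<Rightarrow> mesh" where
  "insert_mesh = (\<lambda>(\<sigma>, S) (a, b) (\<tau>, R).
     let k = length \<tau>; m = length \<sigma>; \<sigma>' = map (\<lambda>v. if v \<le> b then v else v + k) \<sigma> in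
     (take a \<sigma>' @ map (\<lambda>v. v + b) \<tau> @ drop a \<sigma>',
      {(c, d) \<in> {0..m + k} \<times> {0..m + k}. (coarse a k c, coarse b k d) \<in> S} \<union>
      {(a + r, b + s) | r s. (r, s) \<in> R}))"

text \<open>The word order-isomorphic to \<open>xs\<close> whose letters are \<open>1, \<dots>, length xs\<close> (for distinct \<open>xs\<close>).\<close>

definition standardize :: "nat list \<Rightarrow> nat list" where
  "standardize xs = map (\<lambda>v. card {u \<in> set xs. u \<le> v}) xs"

text \<open>Coefficients with respect to \<open>x\<close> are polynomials in \<open>q\<close>, so that \<open>F_p(x, q)\<close> is an element of
  \<open>\<int>[q][[x]]\<close>.\<close>

definition gf_dist :: "mesh \<Rightarrow> int poly fps" where
  "gf_dist p = Abs_fps (\<lambda>n. \<Sum>\<pi>\<in>Perms n. monom 1 (occ_count p \<pi>))"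

definition gf_avoid :: "mesh \<Rightarrow> int fps" where
  "gf_avoid p = Abs_fps (\<lambda>n. int (card {\<pi> \<in> Perms n. occ_count p \<pi> = 0}))"

definition gf_fact :: "'a::comm_ring_1 fps" where
  "gf_fact = Abs_fps (\<lambda>n. of_nat (fact n))"

subsection \<open>Occurrences of the pattern obtained by insertion\<close>

text \<open>
  \<open>insert_mesh\<close> yields a mesh pattern (\<open>mesh_pattern_insert_mesh\<close>), and an occurrence of it is an
  occurrence \<open>us\<close> of the base pattern together with an occurrence \<open>js\<close> of the inserted pattern in
  the permutation order-isomorphic to the elements of \<open>\<pi>\<close> in the box \<open>(a, b)\<close>
  (\<open>occurrence_insert_mesh\<close>).
\<close>

lemma mesh_pattern_insert_mesh:
  assumes base: "mesh_pattern (\<sigma>, S)" and ins: "mesh_pattern (\<tau>, R)"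
    and ab: "a \<le> length \<sigma>" "b \<le> length \<sigma>"
  shows "mesh_pattern (insert_mesh (\<sigma>, S) (a, b) (\<tau>, R))"
proof -
  let ?k = "length \<tau>" and ?m = "length \<sigma>"
  let ?f = "\<lambda>v. if v \<le> b then v else v + ?k" and ?g = "\<lambda>v. v + b"
  let ?s = "map ?f \<sigma>"
  let ?w = "take a ?s @ map ?g \<tau> @ drop a ?s"
  have \<sigma>: "set \<sigma> = {1..?m}" "distinct \<sigma>" and \<tau>: "set \<tau> = {1..?k}" "distinct \<tau>"
    and R: "R \<subseteq> {0..?k} \<times> {0..?k}"
    using base ins by (auto simp: mesh_pattern_def permutations_of_set_def)
  have len: "length ?w = ?m + ?k" using ab by simp
  have "mset ?w = mset (take a ?s @ drop a ?s) + mset (map ?g \<tau>)"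
    unfolding mset_append by (simp only: add_ac)
  also have "\<dots> = mset (?s @ map ?g \<tau>)" by (simp only: append_take_drop_id mset_append)
  finally have mset: "mset ?w = mset (?s @ map ?g \<tau>)" .
  have "set ?w = set (?s @ map ?g \<tau>)" using mset by (rule mset_eq_setD)
  also have "\<dots> = ?f ` {1..?m} \<union> ?g ` {1..?k}" using \<sigma> \<tau> by simp
  also have "\<dots> = {1..?m + ?k}"
  proof (intro equalityI subsetI)
    fix v assume "v \<in> ?f ` {1..?m} \<union> ?g ` {1..?k}"
    then show "v \<in> {1..?m + ?k}" using ab by auto
  next
    fix v assume v: "v \<in> {1..?m + ?k}"
    consider "v \<le> b" | "b < v" "v \<le> b + ?k" | "b + ?k < v" by linarith
    then show "v \<in> ?f ` {1..?m} \<union> ?g ` {1..?k}"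
    proof cases
      case 1
      then show ?thesis using v ab by (intro UnI1 image_eqI[of _ _ v]) auto
    next
      case 2
      then show ?thesis using v ab by (intro UnI2 image_eqI[of _ _ "v - b"]) auto
    next
      case 3
      then show ?thesis using v ab by (intro UnI1 image_eqI[of _ _ "v - ?k"]) auto
    qed
  qed
  finally have set: "set ?w = {1..length ?w}" unfolding len .
  then have "distinct ?w" by (intro card_distinct) simp
  then have "?w \<in> Perms (length ?w)" using set by (simp only: permutations_of_set_def mem_Collect_eq)
  moreover have "(a + r, b + s) \<in> {0..length ?w} \<times> {0..length ?w}" if "(r, s) \<in> R" for r s
  proof -
    have "r \<le> ?k" "s \<le> ?k" using that R by auto
    then show ?thesis using ab unfolding len by simp
  qed
  ultimately show ?thesis
    unfolding insert_mesh_def mesh_pattern_def Let_def split_conv fst_conv snd_conv len by blast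
qed

lemma PermsD:
  assumes "\<pi> \<in> Perms n"
  shows "length \<pi> = n" "set \<pi> = {1..n}" "distinct \<pi>"
    "inj_on (entry \<pi>) {1..n}" "\<And>j. j \<in> {1..n} \<Longrightarrow> entry \<pi> j \<in> {1..n}"
proof -
  show s: "set \<pi> = {1..n}" and d: "distinct \<pi>"
    using assms by (auto simp: permutations_of_set_def)
  show l: "length \<pi> = n" using distinct_card[OF d] s by simp
  show "inj_on (entry \<pi>) {1..n}"
    unfolding inj_on_def entry_def using d l by (auto simp: nth_eq_iff_index_eq)
  show "entry \<pi> j \<in> {1..n}" if "j \<in> {1..n}" for j
    using that l s nth_mem[of "j - 1" \<pi>] by (auto simp: entry_def)
qed

lemma order_iso_zip:
  "order_iso xs ys \<longleftrightarrow> length xs = length ys \<and>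
     (\<forall>(x, y) \<in> set (zip xs ys). \<forall>(x', y') \<in> set (zip xs ys). x < x' \<longleftrightarrow> y < y')"
  by (fastforce simp: order_iso_def set_zip)

lemma nth_less_iff_card:
  fixes xs :: "nat list"
  assumes "sorted_wrt (<) xs" "t < length xs"
  shows "xs ! t < j \<longleftrightarrow> t < card {x \<in> set xs. x < j}"
  using assms
proof (induction xs arbitrary: t)
  case (Cons x xs)
  have fin: "finite {y \<in> set xs. y < j}" by simp
  have x: "x \<notin> set xs" using Cons.prems by auto
  show ?case
  proof (cases "x < j")
    case True
    then have "{y \<in> set (x # xs). y < j} = insert x {y \<in> set xs. y < j}" by auto
    then have "card {y \<in> set (x # xs). y < j} = Suc (card {y \<in> set xs. y < j})"
      using x by simp
    then show ?thesis using Cons True by (cases t) auto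
  next
    case False
    then have e: "{y \<in> set (x # xs). y < j} = {}" using Cons.prems by auto
    have "x \<le> (x # xs) ! t" using Cons.prems by (cases t) (auto intro: less_imp_le)
    then show ?thesis using False unfolding e by simp
  qed
qed simp

lemma grid_iff:
  assumes "sorted_wrt (<) xs" "j \<in> {1..n}" "r \<le> length xs"
  shows "grid n xs r < j \<and> j < grid n xs (r + 1) \<longleftrightarrow>
           j \<notin> set xs \<and> card {x \<in> set xs. x < j} = r"
proof -
  let ?c = "card {x \<in> set xs. x < j}" and ?d = "card {x \<in> set xs. x < Suc j}"
  have "distinct xs" using assms(1) by (simp add: strict_sorted_iff)
  then have len: "card (set xs) = length xs" by (rule distinct_card)
  have 1: "grid n xs r < j \<longleftrightarrow> r \<le> ?c"
  proof (cases r)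
    case 0 then show ?thesis using assms(2) by (simp add: grid_def)
  next
    case (Suc r')
    then show ?thesis using assms nth_less_iff_card[of xs r' j]
      by (auto simp: grid_def nth_append)
  qed
  have dl: "?d \<le> length xs" unfolding len[symmetric] by (rule card_mono) auto
  have 2: "j < grid n xs (r + 1) \<longleftrightarrow> ?d \<le> r"
  proof (cases "r = length xs")
    case True then show ?thesis using assms(2) dl by (simp add: grid_def nth_append)
  next
    case False
    then show ?thesis using assms nth_less_iff_card[of xs r "Suc j"]
      by (auto simp: grid_def nth_append)
  qed
  have cd: "?c \<le> ?d" by (rule card_mono) auto
  have 3: "?d = (if j \<in> set xs then Suc ?c else ?c)"
  proof (cases "j \<in> set xs")
    case True
    then have "{x \<in> set xs. x < Suc j} = insert j {x \<in> set xs. x < j}" by auto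
    then show ?thesis using True by simp
  next
    case False
    then have "{x \<in> set xs. x < Suc j} = {x \<in> set xs. x < j}" by (auto simp: less_Suc_eq)
    then show ?thesis using False by simp
  qed
  show ?thesis unfolding 1 2 using cd 3 by (auto split: if_splits)
qed

lemma box_iff:
  assumes "\<pi> \<in> Perms n" "sorted_wrt (<) ps" "set ps \<subseteq> {1..n}" "r \<le> length ps" "s \<le> length ps"
  shows "box \<pi> ps (r, s) = {j \<in> {1..n}. j \<notin> set ps \<and> card {i \<in> set ps. i < j} = r \<and>
                              card {i \<in> set ps. entry \<pi> i < entry \<pi> j} = s}"
proof -
  note P = PermsD[OF assms(1)]
  define vs where "vs = sort (map (entry \<pi>) ps)"
  have inj: "inj_on (entry \<pi>) (set ps)" using P(4) assms(3) by (rule inj_on_subset)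
  have "distinct ps" using assms(2) by (simp add: strict_sorted_iff)
  then have "distinct vs" unfolding vs_def using inj by (simp add: distinct_map)
  then have vs: "sorted_wrt (<) vs" by (simp add: strict_sorted_iff vs_def)
  have svs: "set vs = entry \<pi> ` set ps" "length vs = length ps" by (simp_all add: vs_def)
  have "grid n ps r < j \<and> j < grid n ps (r + 1) \<and>
        grid n vs s < entry \<pi> j \<and> entry \<pi> j < grid n vs (s + 1) \<longleftrightarrow>
        j \<notin> set ps \<and> card {i \<in> set ps. i < j} = r \<and>
        card {i \<in> set ps. entry \<pi> i < entry \<pi> j} = s" if j: "j \<in> {1..n}" for j
  proof -
    have "{x \<in> set vs. x < entry \<pi> j} = entry \<pi> ` {i \<in> set ps. entry \<pi> i < entry \<pi> j}"
      by (auto simp: svs)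
    moreover have "inj_on (entry \<pi>) {i \<in> set ps. entry \<pi> i < entry \<pi> j}"
      using inj by (rule inj_on_subset) auto
    ultimately have c: "card {x \<in> set vs. x < entry \<pi> j} =
        card {i \<in> set ps. entry \<pi> i < entry \<pi> j}" by (simp add: card_image)
    have m: "entry \<pi> j \<in> set vs \<longleftrightarrow> j \<in> set ps"
      unfolding svs by (rule inj_on_image_mem_iff[OF P(4) j assms(3)])
    show ?thesis
      using grid_iff[OF assms(2) j assms(4)]
        grid_iff[OF vs P(5)[OF j], of s, unfolded svs(2), OF assms(5)] c m by auto
  qed
  then show ?thesis by (auto simp: box_def Let_def P(1) vs_def[symmetric])
qed

lemma card_less_eq_iff:
  assumes iso: "order_iso xs \<sigma>" and \<sigma>: "\<sigma> \<in> Perms m" and b: "b \<le> m" and y: "y \<notin> set xs"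
  shows "card {t \<in> {..<m}. xs ! t < y} = b \<longleftrightarrow> (\<forall>t<m. xs ! t < y \<longleftrightarrow> \<sigma> ! t \<le> b)"
proof -
  note P = PermsD[OF \<sigma>]
  have lx: "length xs = m" using iso P(1) by (simp add: order_iso_def)
  define D where "D = {t \<in> {..<m}. xs ! t < y}"
  define E where "E = {t \<in> {..<m}. \<sigma> ! t \<le> b}"
  have fin: "finite D" "finite E" by (auto simp: D_def E_def)
  have inj: "inj_on ((!) \<sigma>) E"
    using P(1,3) by (auto simp: inj_on_def E_def nth_eq_iff_index_eq)
  have "(!) \<sigma> ` E = {1..b}"
  proof (intro equalityI subsetI)
    fix v assume "v \<in> (!) \<sigma> ` E"
    then obtain t where t: "t < m" "\<sigma> ! t \<le> b" "v = \<sigma> ! t" by (auto simp: E_def)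
    then have "v \<in> set \<sigma>" using P(1) nth_mem by simp
    then show "v \<in> {1..b}" using t P(2) by auto
  next
    fix v assume v: "v \<in> {1..b}"
    then have "v \<in> set \<sigma>" using P(2) b by simp
    then show "v \<in> (!) \<sigma> ` E" using v P(1) by (auto simp: in_set_conv_nth E_def)
  qed
  then have cE: "card E = b" using card_image[OF inj] by simp
  have "D \<subseteq> E \<or> E \<subseteq> D"
  proof (rule ccontr)
    assume "\<not> ?thesis"
    then obtain t u where tu: "t \<in> D" "t \<notin> E" "u \<in> E" "u \<notin> D" by auto
    then have "t < m" "u < m" "\<sigma> ! u < \<sigma> ! t" by (auto simp: D_def E_def)
    then have "xs ! u < xs ! t" using iso lx by (simp add: order_iso_def)
    then show False using tu by (auto simp: D_def E_def)
  qed
  then have "card D = b \<longleftrightarrow> D = E"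
    using cE fin by (metis card_subset_eq)
  then show ?thesis unfolding D_def E_def by blast
qed

lemma order_iso_insert:
  assumes \<sigma>: "\<sigma> \<in> Perms (length (A @ B))" and b: "b \<le> length (A @ B)"
    and disj: "set M \<inter> set (A @ B) = {}" and \<tau>: "\<tau> \<in> Perms k" and lM: "length M = k"
    and \<sigma>': "\<sigma>' = map (\<lambda>v. if v \<le> b then v else v + k) \<sigma>"
  shows "order_iso (A @ M @ B) (take (length A) \<sigma>' @ map (\<lambda>v. v + b) \<tau> @ drop (length A) \<sigma>') \<longleftrightarrow>
     order_iso (A @ B) \<sigma> \<and> order_iso M \<tau> \<and>
     (\<forall>y\<in>set M. card {t \<in> {..<length (A @ B)}. (A @ B) ! t < y} = b)"
proof -
  let ?m = "length (A @ B)" and ?A' = "take (length A) \<sigma>'" and ?B' = "drop (length A) \<sigma>'"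
  let ?M' = "map (\<lambda>v. v + b) \<tau>"
  note P = PermsD[OF \<sigma>] and Q = PermsD[OF \<tau>]
  have l: "length A = length ?A'" "length B = length ?B'" "length M = length ?M'"
    using P(1) Q(1) lM \<sigma>' by auto
  have z: "set (zip (A @ M @ B) (?A' @ ?M' @ ?B')) = set (zip (A @ B) \<sigma>') \<union> set (zip M ?M')"
  proof -
    have "zip (A @ B) \<sigma>' = zip (A @ B) (?A' @ ?B')" by simp
    also have "\<dots> = zip A ?A' @ zip B ?B'" using l by (intro zip_append) auto
    finally show ?thesis using l by (simp add: zip_append Un_ac)
  qed
  have zs: "set (zip (A @ B) \<sigma>') =
      (\<lambda>(x, v). (x, if v \<le> b then v else v + k)) ` set (zip (A @ B) \<sigma>)"
    unfolding \<sigma>' zip_map2 by auto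
  have zt: "set (zip M ?M') = (\<lambda>(x, v). (x, v + b)) ` set (zip M \<tau>)"
    unfolding zip_map2 by auto
  have zsI: "(x, if v \<le> b then v else v + k) \<in> set (zip (A @ B) \<sigma>')"
    if "(x, v) \<in> set (zip (A @ B) \<sigma>)" for x v
    unfolding zs by (rule rev_image_eqI[OF that]) simp
  have ztI: "(x, v + b) \<in> set (zip M ?M')" if "(x, v) \<in> set (zip M \<tau>)" for x v
    unfolding zt by (rule rev_image_eqI[OF that]) simp
  have tk: "v \<in> {1..k}" if "(x, v) \<in> set (zip M \<tau>)" for x v
    using set_zip_rightD[OF that] Q(2) by simp
  define C where "C \<longleftrightarrow> (\<forall>(y, w)\<in>set (zip M \<tau>). \<forall>(x, v)\<in>set (zip (A @ B) \<sigma>). x < y \<longleftrightarrow> v \<le> b)"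
  have main: "order_iso (A @ M @ B) (?A' @ ?M' @ ?B') \<longleftrightarrow>
      order_iso (A @ B) \<sigma> \<and> order_iso M \<tau> \<and> C"
    (is "?L \<longleftrightarrow> ?R")
  proof
    assume ?L
    then have *: "x < x' \<longleftrightarrow> y < y'"
      if "(x, y) \<in> set (zip (A @ B) \<sigma>') \<union> set (zip M ?M')"
         "(x', y') \<in> set (zip (A @ B) \<sigma>') \<union> set (zip M ?M')" for x y x' y'
      using that unfolding order_iso_zip z by blast
    have 1: "x < x' \<longleftrightarrow> v < v'"
      if "(x, v) \<in> set (zip (A @ B) \<sigma>)" "(x', v') \<in> set (zip (A @ B) \<sigma>)" for x v x' v'
    proof -
      have "x < x' \<longleftrightarrow> (if v \<le> b then v else v + k) < (if v' \<le> b then v' else v' + k)"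
        by (rule *) (use zsI that in blast)+
      then show ?thesis by (auto split: if_splits)
    qed
    have 2: "x < x' \<longleftrightarrow> v < v'"
      if "(x, v) \<in> set (zip M \<tau>)" "(x', v') \<in> set (zip M \<tau>)" for x v x' v'
    proof -
      have "x < x' \<longleftrightarrow> v + b < v' + b"
        by (rule *) (use ztI that in blast)+
      then show ?thesis by simp
    qed
    have 3: "x < y \<longleftrightarrow> v \<le> b"
      if "(y, w) \<in> set (zip M \<tau>)" "(x, v) \<in> set (zip (A @ B) \<sigma>)" for x v y w
    proof -
      have "x < y \<longleftrightarrow> (if v \<le> b then v else v + k) < w + b"
        by (rule *) (use zsI ztI that in blast)+
      then show ?thesis using tk[OF that(1)] by (auto split: if_splits)
    qed
    show ?R unfolding order_iso_zip C_def using 1 2 3 P(1) Q(1) lM by auto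
  next
    assume R: ?R
    have 1: "x < x' \<longleftrightarrow> v < v'"
      if "(x, v) \<in> set (zip (A @ B) \<sigma>)" "(x', v') \<in> set (zip (A @ B) \<sigma>)" for x v x' v'
      using R that unfolding order_iso_zip by blast
    have 2: "x < x' \<longleftrightarrow> v < v'"
      if "(x, v) \<in> set (zip M \<tau>)" "(x', v') \<in> set (zip M \<tau>)" for x v x' v'
      using R that unfolding order_iso_zip by blast
    have 3: "x < y \<longleftrightarrow> v \<le> b"
      if "(y, w) \<in> set (zip M \<tau>)" "(x, v) \<in> set (zip (A @ B) \<sigma>)" for x v y w
      using R that unfolding C_def by blast
    have ne: "x \<noteq> y"
      if "(y, w) \<in> set (zip M \<tau>)" "(x, v) \<in> set (zip (A @ B) \<sigma>)" for x v y w
      using set_zip_leftD[OF that(1)] set_zip_leftD[OF that(2)] disj by blast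
    have "x < x' \<longleftrightarrow> y < y'"
      if h: "(x, y) \<in> set (zip (A @ B) \<sigma>') \<union> set (zip M ?M')"
         "(x', y') \<in> set (zip (A @ B) \<sigma>') \<union> set (zip M ?M')" for x y x' y'
    proof -
      consider (aa) "(x, y) \<in> set (zip (A @ B) \<sigma>')" "(x', y') \<in> set (zip (A @ B) \<sigma>')"
        | (am) "(x, y) \<in> set (zip (A @ B) \<sigma>')" "(x', y') \<in> set (zip M ?M')"
        | (ma) "(x, y) \<in> set (zip M ?M')" "(x', y') \<in> set (zip (A @ B) \<sigma>')"
        | (mm) "(x, y) \<in> set (zip M ?M')" "(x', y') \<in> set (zip M ?M')"
        using h by blast
      then show ?thesis
      proof cases
        case aa
        then obtain v v' where "(x, v) \<in> set (zip (A @ B) \<sigma>)" "(x', v') \<in> set (zip (A @ B) \<sigma>)"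
          "y = (if v \<le> b then v else v + k)" "y' = (if v' \<le> b then v' else v' + k)"
          unfolding zs by auto
        then show ?thesis using 1[of x v x' v'] by auto
      next
        case am
        then obtain v w where vw: "(x, v) \<in> set (zip (A @ B) \<sigma>)" "(x', w) \<in> set (zip M \<tau>)"
          "y = (if v \<le> b then v else v + k)" "y' = w + b"
          unfolding zs zt by auto
        then show ?thesis using 3[of x' w x v] tk[of x' w] by auto
      next
        case ma
        then obtain v w where vw: "(x', v) \<in> set (zip (A @ B) \<sigma>)" "(x, w) \<in> set (zip M \<tau>)"
          "y' = (if v \<le> b then v else v + k)" "y = w + b"
          unfolding zs zt by auto
        then show ?thesis using 3[of x w x' v] tk[of x w] ne[of x w x' v] by auto
      next
        case mm
        then obtain v v' where "(x, v) \<in> set (zip M \<tau>)" "(x', v') \<in> set (zip M \<tau>)"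
          "y = v + b" "y' = v' + b"
          unfolding zt by auto
        then show ?thesis using 2[of x v x' v'] by auto
      qed
    qed
    moreover have "length (A @ M @ B) = length (?A' @ ?M' @ ?B')" using l by simp
    ultimately show ?L unfolding order_iso_zip z by blast
  qed
  have C: "C \<longleftrightarrow> (\<forall>y\<in>set M. card {t \<in> {..<?m}. (A @ B) ! t < y} = b)"
    if iso: "order_iso (A @ B) \<sigma>"
  proof -
    have M: "set M = fst ` set (zip M \<tau>)"
      using lM Q(1) by (metis map_fst_zip set_map)
    have eq: "(\<forall>(x, v)\<in>set (zip (A @ B) \<sigma>). x < y \<longleftrightarrow> v \<le> b) \<longleftrightarrow>
          card {t \<in> {..<?m}. (A @ B) ! t < y} = b" if "y \<in> set M" for y
    proof -
      have "y \<notin> set (A @ B)" using that disj by blast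
      then have "card {t \<in> {..<?m}. (A @ B) ! t < y} = b \<longleftrightarrow>
          (\<forall>t<?m. (A @ B) ! t < y \<longleftrightarrow> \<sigma> ! t \<le> b)"
        by (rule card_less_eq_iff[OF iso \<sigma> b])
      then show ?thesis using P(1) by (auto simp: set_zip)
    qed
    have "C \<longleftrightarrow> (\<forall>y\<in>set M. \<forall>(x, v)\<in>set (zip (A @ B) \<sigma>). x < y \<longleftrightarrow> v \<le> b)"
      unfolding C_def M by (simp add: case_prod_beta)
    also have "\<dots> \<longleftrightarrow> (\<forall>y\<in>set M. card {t \<in> {..<?m}. (A @ B) ! t < y} = b)"
      by (intro ball_cong refl eq)
    finally show ?thesis .
  qed
  show ?thesis using main C by blast
qed

lemma sorted_insert_iff:
  fixes A M B :: "nat list"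
  assumes disj: "set M \<inter> set (A @ B) = {}"
  shows "sorted_wrt (<) (A @ M @ B) \<longleftrightarrow> sorted_wrt (<) (A @ B) \<and> sorted_wrt (<) M \<and>
     (\<forall>j\<in>set M. card {i \<in> set (A @ B). i < j} = length A)"
proof -
  have "card {i \<in> set (A @ B). i < j} = length A \<longleftrightarrow> (\<forall>i\<in>set A. i < j) \<and> (\<forall>i\<in>set B. j < i)"
    if s: "sorted_wrt (<) (A @ B)" and j: "j \<in> set M" for j
  proof
    assume c: "card {i \<in> set (A @ B). i < j} = length A"
    have n: "(A @ B) ! t < j \<longleftrightarrow> t < length A" if "t < length (A @ B)" for t
      using nth_less_iff_card[OF s that, of j] c by simp
    have "i < j" if "i \<in> set A" for i
      using that n by (metis in_set_conv_nth length_append nth_append trans_less_add1)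
    moreover have "j < i" if iB: "i \<in> set B" for i
    proof -
      obtain t where "t < length B" "i = B ! t" using iB by (metis in_set_conv_nth)
      then have "\<not> i < j" using n[of "length A + t"] by simp
      moreover have "i \<noteq> j" using iB j disj by auto
      ultimately show ?thesis by simp
    qed
    ultimately show "(\<forall>i\<in>set A. i < j) \<and> (\<forall>i\<in>set B. j < i)" by blast
  next
    assume h: "(\<forall>i\<in>set A. i < j) \<and> (\<forall>i\<in>set B. j < i)"
    then have "{i \<in> set (A @ B). i < j} = set A" by fastforce
    moreover have "distinct A" using s by (simp add: sorted_wrt_append strict_sorted_iff)
    ultimately show "card {i \<in> set (A @ B). i < j} = length A" by (simp add: distinct_card)
  qed
  then show ?thesis by (auto simp: sorted_wrt_append)
qed

lemma standardize_Perms: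
  assumes "distinct xs"
  shows "standardize xs \<in> Perms (length xs)"
    and "i < length xs \<Longrightarrow> j < length xs \<Longrightarrow>
           standardize xs ! i < standardize xs ! j \<longleftrightarrow> xs ! i < xs ! j"
proof -
  let ?f = "\<lambda>v. card {u \<in> set xs. u \<le> v}"
  have mono: "?f v < ?f w" if "v < w" "w \<in> set xs" for v w
  proof (rule psubset_card_mono)
    have "w \<in> {u \<in> set xs. u \<le> w}" "w \<notin> {u \<in> set xs. u \<le> v}" using that by auto
    moreover have "{u \<in> set xs. u \<le> v} \<subseteq> {u \<in> set xs. u \<le> w}" using that by auto
    ultimately show "{u \<in> set xs. u \<le> v} \<subset> {u \<in> set xs. u \<le> w}" by blast
  qed simp
  have iff: "?f v < ?f w \<longleftrightarrow> v < w" if "v \<in> set xs" "w \<in> set xs" for v w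
    using mono[of v w] mono[of w v] that by (cases v w rule: linorder_cases) auto
  have inj: "inj_on ?f (set xs)"
  proof (rule inj_onI)
    fix v w assume "v \<in> set xs" "w \<in> set xs" "?f v = ?f w"
    then show "v = w" using mono[of v w] mono[of w v] by (cases v w rule: linorder_cases) auto
  qed
  have sub: "?f ` set xs \<subseteq> {1..length xs}"
  proof safe
    fix v assume v: "v \<in> set xs"
    then have "{u \<in> set xs. u \<le> v} \<noteq> {}" by auto
    then have "0 < ?f v" by (simp only: card_gt_0_iff) simp
    moreover have "?f v \<le> card (set xs)" by (rule card_mono) auto
    ultimately show "?f v \<in> {1..length xs}"
      unfolding distinct_card[OF assms] atLeastAtMost_iff by linarith
  qed
  have "?f ` set xs = {1..length xs}"
    by (rule card_subset_eq[OF _ sub]) (simp_all add: card_image[OF inj] distinct_card[OF assms])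
  then show "standardize xs \<in> Perms (length xs)"
    using inj assms by (auto simp: standardize_def permutations_of_set_def distinct_map)
  show "standardize xs ! i < standardize xs ! j \<longleftrightarrow> xs ! i < xs ! j"
    if "i < length xs" "j < length xs"
    using that iff by (simp add: standardize_def)
qed

lemma coarse_eq:
  assumes "c0 < a \<Longrightarrow> c = c0" "a < c0 \<Longrightarrow> c = c0 + k" "c0 = a \<Longrightarrow> a \<le> c \<and> c \<le> a + k"
  shows "coarse a k c = c0"
  using assms by (cases c0 a rule: linorder_cases) (auto simp: coarse_def)

lemma order_iso_map_cong:
  assumes "\<And>x y. x \<in> set xs \<Longrightarrow> y \<in> set xs \<Longrightarrow> f x < f y \<longleftrightarrow> g x < g y"
  shows "order_iso (map f xs) \<tau> \<longleftrightarrow> order_iso (map g xs) \<tau>"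
  using assms by (auto simp: order_iso_def)

text \<open>If every element of \<open>M\<close> sees exactly \<open>a\<close> elements of \<open>U\<close> below it (with respect to \<open>f\<close>),
  then the refined column number of \<open>j\<close> determines, and refines, the base column number.\<close>

lemma refined_count:
  fixes f :: "nat \<Rightarrow> nat"
  assumes fin: "finite U" "finite M" and UM: "U \<inter> M = {}" and cM: "card M = k"
    and a: "\<And>x. x \<in> M \<Longrightarrow> card {i \<in> U. f i < f x} = a"
    and j: "\<And>x. x \<in> M \<Longrightarrow> f x \<noteq> f j"
  shows "card {i \<in> U \<union> M. f i < f j} = card {i \<in> U. f i < f j} + card {i \<in> M. f i < f j}"
    and "coarse a k (card {i \<in> U \<union> M. f i < f j}) = card {i \<in> U. f i < f j}"
proof -
  let ?c0 = "card {i \<in> U. f i < f j}" and ?cm = "card {i \<in> M. f i < f j}"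
  have "{i \<in> U \<union> M. f i < f j} = {i \<in> U. f i < f j} \<union> {i \<in> M. f i < f j}" by auto
  then show sum: "card {i \<in> U \<union> M. f i < f j} = ?c0 + ?cm"
    using fin UM by (simp add: card_Un_disjoint disjoint_iff)
  have cmk: "?cm \<le> k" unfolding cM[symmetric] by (rule card_mono) (use fin in auto)
  show "coarse a k (card {i \<in> U \<union> M. f i < f j}) = ?c0"
  proof (rule coarse_eq)
    assume lt: "?c0 < a"
    have "\<not> f x < f j" if "x \<in> M" for x
    proof
      assume "f x < f j"
      then have "card {i \<in> U. f i < f x} \<le> ?c0" by (intro card_mono) (use fin in auto)
      then show False using a[OF that] lt by simp
    qed
    then have e: "{i \<in> M. f i < f j} = {}" by auto
    have "?cm = 0" by (simp only: e card.empty)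
    then show "card {i \<in> U \<union> M. f i < f j} = ?c0" unfolding sum by simp
  next
    assume lt: "a < ?c0"
    have "f x < f j" if "x \<in> M" for x
    proof (rule ccontr)
      assume "\<not> f x < f j"
      then have "?c0 \<le> card {i \<in> U. f i < f x}" by (intro card_mono) (use fin in auto)
      then show False using a[OF that] lt by simp
    qed
    then have e: "{i \<in> M. f i < f j} = M" by auto
    have "?cm = k" by (simp only: e cM)
    then show "card {i \<in> U \<union> M. f i < f j} = ?c0 + k" unfolding sum by simp
  next
    assume "?c0 = a"
    then show "a \<le> card {i \<in> U \<union> M. f i < f j} \<and> card {i \<in> U \<union> M. f i < f j} \<le> a + k"
      unfolding sum using cmk by simp
  qed
qed

lemma card_nth_entry:
  assumes "distinct us"
  shows "card {t \<in> {..<length us}. map f us ! t < (y::nat)} = card {i \<in> set us. f i < y}"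
proof -
  have "{i \<in> set us. f i < y} = (!) us ` {t \<in> {..<length us}. map f us ! t < y}"
    by (auto simp: in_set_conv_nth)
  moreover have "inj_on ((!) us) {t \<in> {..<length us}. map f us ! t < y}"
    using assms by (auto simp: inj_on_def nth_eq_iff_index_eq)
  ultimately show ?thesis by (simp add: card_image)
qed

lemma occurrence_split:
  assumes base: "mesh_pattern (\<sigma>, S)" and ins: "mesh_pattern (\<tau>, R)"
    and ab: "a \<le> length \<sigma>" "b \<le> length \<sigma>" "(a, b) \<notin> S" and \<pi>: "\<pi> \<in> Perms n"
    and len: "length A = a" "length (A @ B) = length \<sigma>" "length M = length \<tau>"
  shows "occurrence (insert_mesh (\<sigma>, S) (a, b) (\<tau>, R)) \<pi> (A @ M @ B) \<longleftrightarrow>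
    occurrence (\<sigma>, S) \<pi> (A @ B) \<and> sorted_wrt (<) M \<and> set M \<subseteq> box \<pi> (A @ B) (a, b) \<and>
    order_iso (map (entry \<pi>) M) \<tau> \<and>
    (\<forall>(r, s)\<in>R. \<forall>j\<in>box \<pi> (A @ B) (a, b) - set M.
       \<not> (card {i \<in> set M. i < j} = r \<and> card {i \<in> set M. entry \<pi> i < entry \<pi> j} = s))"
    (is "?L \<longleftrightarrow> ?R")
proof -
  note P = PermsD[OF \<pi>]
  let ?e = "entry \<pi>" and ?U = "set (A @ B)" and ?k = "length \<tau>" and ?m = "length \<sigma>"
  let ?us = "A @ B"
  have \<sigma>: "\<sigma> \<in> Perms ?m" and SS: "S \<subseteq> {0..?m} \<times> {0..?m}"
    and \<tau>: "\<tau> \<in> Perms ?k" and RR: "R \<subseteq> {0..?k} \<times> {0..?k}"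
    using base ins by (auto simp: mesh_pattern_def)
  define \<sigma>' where "\<sigma>' = map (\<lambda>v. if v \<le> b then v else v + ?k) \<sigma>"
  define S1 where "S1 = {(c, d) \<in> {0..?m + ?k} \<times> {0..?m + ?k}. (coarse a ?k c, coarse b ?k d) \<in> S}"
  define S2 where "S2 = {(a + r, b + s) | r s. (r, s) \<in> R}"
  have ieq: "insert_mesh (\<sigma>, S) (a, b) (\<tau>, R) =
      (take a \<sigma>' @ map (\<lambda>v. v + b) \<tau> @ drop a \<sigma>', S1 \<union> S2)"
    by (simp add: insert_mesh_def Let_def \<sigma>'_def S1_def S2_def)
  define shape where "shape \<longleftrightarrow> sorted_wrt (<) ?us \<and> ?U \<subseteq> {1..n} \<and> order_iso (map ?e ?us) \<sigma> \<and>
     sorted_wrt (<) M \<and> set M \<subseteq> box \<pi> ?us (a, b) \<and> order_iso (map ?e M) \<tau>"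
  have shapeL: "sorted_wrt (<) (A @ M @ B) \<and> set (A @ M @ B) \<subseteq> {1..n} \<and>
     order_iso (map ?e (A @ M @ B)) (take a \<sigma>' @ map (\<lambda>v. v + b) \<tau> @ drop a \<sigma>') \<longleftrightarrow> shape"
    (is "?S \<longleftrightarrow> _")
  proof (cases "sorted_wrt (<) ?us \<and> ?U \<subseteq> {1..n} \<and> set M \<subseteq> {1..n} \<and> set M \<inter> ?U = {}")
    case False
    have "\<not> ?S" using False by (auto simp: sorted_wrt_append)
    moreover have "\<not> shape"
    proof
      assume s: shape
      then have "set M \<subseteq> {j \<in> {1..n}. j \<notin> ?U \<and> card {i \<in> ?U. i < j} = a \<and>
                              card {i \<in> ?U. ?e i < ?e j} = b}"
        using box_iff[OF \<pi>, of ?us a b] ab len by (auto simp: shape_def)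
      then show False using False s by (auto simp: shape_def)
    qed
    ultimately show ?thesis by simp
  next
    case True
    then have dist: "distinct ?us" by (simp add: strict_sorted_iff)
    have bx: "box \<pi> ?us (a, b) = {j \<in> {1..n}. j \<notin> ?U \<and> card {i \<in> ?U. i < j} = a \<and>
                              card {i \<in> ?U. ?e i < ?e j} = b}"
      by (rule box_iff) (use True \<pi> ab len in auto)
    have inj: "inj_on ?e (?U \<union> set M)" using P(4) by (rule inj_on_subset) (use True in auto)
    have "?e ` set M \<inter> ?e ` ?U = ?e ` (set M \<inter> ?U)"
      using inj by (intro inj_on_image_Int[symmetric, of _ "?U \<union> set M"]) auto
    then have dj: "set (map ?e M) \<inter> set (map ?e A @ map ?e B) = {}"
      using True by (simp add: image_Un)
    have oi: "order_iso (map ?e (A @ M @ B)) (take a \<sigma>' @ map (\<lambda>v. v + b) \<tau> @ drop a \<sigma>') \<longleftrightarrow>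
       order_iso (map ?e ?us) \<sigma> \<and> order_iso (map ?e M) \<tau> \<and>
       (\<forall>y\<in>set M. card {i \<in> ?U. ?e i < ?e y} = b)"
      using order_iso_insert[OF _ _ dj \<tau>, of \<sigma> b \<sigma>'] \<sigma> ab len \<sigma>'_def
        card_nth_entry[OF dist, of ?e] by simp
    show ?thesis unfolding oi shape_def bx
      using True sorted_insert_iff[of M A B] len by auto
  qed
  have boxes: "(\<forall>x\<in>S1 \<union> S2. box \<pi> (A @ M @ B) x = {}) \<longleftrightarrow>
      (\<forall>x\<in>S. box \<pi> ?us x = {}) \<and>
      (\<forall>(r, s)\<in>R. \<forall>j\<in>box \<pi> ?us (a, b) - set M.
       \<not> (card {i \<in> set M. i < j} = r \<and> card {i \<in> set M. ?e i < ?e j} = s))"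
    if shape
  proof -
    have S: "sorted_wrt (<) (A @ M @ B)" "set (A @ M @ B) \<subseteq> {1..n}"
      using shapeL that by auto
    have us: "sorted_wrt (<) ?us" "?U \<subseteq> {1..n}" "set M \<subseteq> box \<pi> ?us (a, b)"
      "sorted_wrt (<) M" using that by (auto simp: shape_def)
    define c0 where "c0 j = card {i \<in> ?U. i < j}" for j
    define d0 where "d0 j = card {i \<in> ?U. ?e i < ?e j}" for j
    define cm where "cm j = card {i \<in> set M. i < j}" for j
    define dm where "dm j = card {i \<in> set M. ?e i < ?e j}" for j
    define c where "c j = card {i \<in> ?U \<union> set M. i < j}" for j
    define d where "d j = card {i \<in> ?U \<union> set M. ?e i < ?e j}" for j
    have bx: "box \<pi> ?us (r, s) = {j \<in> {1..n}. j \<notin> ?U \<and> c0 j = r \<and> d0 j = s}"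
      if "r \<le> ?m" "s \<le> ?m" for r s
      unfolding c0_def d0_def by (rule box_iff) (use us \<pi> that len in auto)
    have Ueq: "set (A @ M @ B) = ?U \<union> set M" by auto
    have lam: "length (A @ M @ B) = ?m + ?k" using len by simp
    have bx': "box \<pi> (A @ M @ B) (r, s) =
        {j \<in> {1..n}. j \<notin> ?U \<and> j \<notin> set M \<and> c j = r \<and> d j = s}"
      if "r \<le> ?m + ?k" "s \<le> ?m + ?k" for r s
      using box_iff[OF \<pi> S, of r s] that unfolding Ueq lam c_def d_def by auto
    have M: "j \<in> {1..n}" "j \<notin> ?U" "c0 j = a" "d0 j = b" if "j \<in> set M" for j
      using us(3) that bx[OF ab(1,2)] by auto
    have cM: "card (set M) = ?k"
      using us(4) len distinct_card[of M] by (simp add: strict_sorted_iff)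
    have UM: "?U \<inter> set M = {}" using M(2) by auto
    have C: "c j = c0 j + cm j" "coarse a ?k (c j) = c0 j" if "j \<notin> set M" for j
    proof -
      have ne: "x \<noteq> j" if "x \<in> set M" for x using that \<open>j \<notin> set M\<close> by blast
      note rc = refined_count[where f = "\<lambda>x. x", OF finite_set finite_set UM cM M(3)[unfolded c0_def] ne]
      show "c j = c0 j + cm j" "coarse a ?k (c j) = c0 j"
        unfolding c_def c0_def cm_def by (rule rc, assumption+)+
    qed
    have D: "d j = d0 j + dm j" "coarse b ?k (d j) = d0 j" if "j \<notin> set M" "j \<in> {1..n}" for j
    proof -
      have ne: "?e x \<noteq> ?e j" if "x \<in> set M" for x
        using inj_onD[OF P(4), of x j] M(1)[OF that] \<open>j \<in> {1..n}\<close> \<open>j \<notin> set M\<close> that by blast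
      note rc = refined_count[where f = ?e, OF finite_set finite_set UM cM M(4)[unfolded d0_def] ne]
      show "d j = d0 j + dm j" "coarse b ?k (d j) = d0 j"
        unfolding d_def d0_def dm_def by (rule rc, assumption+)+
    qed
    have cU: "card ?U = ?m"
      using us(1) len distinct_card[of ?us] by (simp add: strict_sorted_iff)
    have bd0: "c0 j \<le> ?m" "d0 j \<le> ?m" for j
      unfolding c0_def d0_def cU[symmetric] by (rule card_mono; auto)+
    have bdm: "cm j \<le> ?k" "dm j \<le> ?k" for j
      unfolding cm_def dm_def cM[symmetric] by (rule card_mono; auto)+
    have 1: "(\<forall>x\<in>S1. box \<pi> (A @ M @ B) x = {}) \<longleftrightarrow>
        (\<forall>j\<in>{1..n}. j \<notin> ?U \<longrightarrow> j \<notin> set M \<longrightarrow> (c0 j, d0 j) \<notin> S)" (is "?l \<longleftrightarrow> ?r")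
    proof
      assume l: ?l
      show ?r
      proof (intro ballI impI notI)
        fix j assume j: "j \<in> {1..n}" "j \<notin> ?U" "j \<notin> set M" "(c0 j, d0 j) \<in> S"
        have bd: "c j \<le> ?m + ?k" "d j \<le> ?m + ?k"
          using C(1)[of j] D(1)[of j] j bd0[of j] bdm[of j] by auto
        then have "(c j, d j) \<in> S1" using j C(2)[of j] D(2)[of j] by (auto simp: S1_def)
        then have "box \<pi> (A @ M @ B) (c j, d j) = {}" using l by blast
        then show False using j bx'[OF bd] by blast
      qed
    next
      assume r: ?r
      show ?l
      proof
        fix x assume "x \<in> S1"
        then obtain u v where x: "x = (u, v)" "u \<le> ?m + ?k" "v \<le> ?m + ?k"
          "(coarse a ?k u, coarse b ?k v) \<in> S" by (auto simp: S1_def)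
        show "box \<pi> (A @ M @ B) x = {}"
          using r x C(2) D(2) unfolding x(1) bx'[OF x(2,3)] by auto
      qed
    qed
    have 2: "(\<forall>x\<in>S2. box \<pi> (A @ M @ B) x = {}) \<longleftrightarrow>
        (\<forall>(r, s)\<in>R. \<forall>j\<in>box \<pi> ?us (a, b) - set M. \<not> (cm j = r \<and> dm j = s))"
    proof -
      have "box \<pi> (A @ M @ B) (a + r, b + s) = {} \<longleftrightarrow>
          (\<forall>j\<in>box \<pi> ?us (a, b) - set M. \<not> (cm j = r \<and> dm j = s))" if "(r, s) \<in> R" for r s
      proof -
        have rs: "r \<le> ?k" "s \<le> ?k" using that RR by auto
        have iff: "c j = a + r \<and> d j = b + s \<longleftrightarrow> c0 j = a \<and> d0 j = b \<and> cm j = r \<and> dm j = s"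
          if "j \<notin> set M" "j \<in> {1..n}" for j
        proof
          assume h: "c j = a + r \<and> d j = b + s"
          then have "c0 j = a" "d0 j = b"
            using C(2)[OF that(1)] D(2)[OF that] rs by (auto simp: coarse_def)
          then show "c0 j = a \<and> d0 j = b \<and> cm j = r \<and> dm j = s"
            using h C(1)[OF that(1)] D(1)[OF that] by simp
        qed (use C(1)[OF that(1)] D(1)[OF that] in simp)
        have "a + r \<le> ?m + ?k" "b + s \<le> ?m + ?k" using ab rs by auto
        note b' = bx'[OF this]
        have "box \<pi> (A @ M @ B) (a + r, b + s) =
            {j \<in> {1..n}. j \<notin> ?U \<and> j \<notin> set M \<and> c0 j = a \<and> d0 j = b \<and> cm j = r \<and> dm j = s}"
          unfolding b' by (intro Collect_cong conj_cong refl iff)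
        then show ?thesis unfolding bx[OF ab(1,2)] by blast
      qed
      then have eq: "(case x of (r, s) \<Rightarrow> box \<pi> (A @ M @ B) (a + r, b + s) = {}) \<longleftrightarrow>
          (case x of (r, s) \<Rightarrow> \<forall>j\<in>box \<pi> ?us (a, b) - set M. \<not> (cm j = r \<and> dm j = s))"
        if "x \<in> R" for x using that by (cases x) (simp only: prod.case)
      have "S2 = (\<lambda>(r, s). (a + r, b + s)) ` R" unfolding S2_def by auto
      then have "(\<forall>x\<in>S2. box \<pi> (A @ M @ B) x = {}) \<longleftrightarrow>
          (\<forall>(r, s)\<in>R. box \<pi> (A @ M @ B) (a + r, b + s) = {})"
        by (simp only: ball_simps(9)) (simp add: case_prod_beta)
      also have "\<dots> \<longleftrightarrow>
          (\<forall>(r, s)\<in>R. \<forall>j\<in>box \<pi> ?us (a, b) - set M. \<not> (cm j = r \<and> dm j = s))"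
        by (intro ball_cong refl eq)
      finally show ?thesis .
    qed
    have 3: "(\<forall>x\<in>S. box \<pi> ?us x = {}) \<longleftrightarrow>
        (\<forall>j\<in>{1..n}. j \<notin> ?U \<longrightarrow> j \<notin> set M \<longrightarrow> (c0 j, d0 j) \<notin> S)" (is "?l \<longleftrightarrow> ?r")
    proof
      assume l: ?l
      show ?r
      proof (intro ballI impI notI)
        fix j assume j: "j \<in> {1..n}" "j \<notin> ?U" "j \<notin> set M" "(c0 j, d0 j) \<in> S"
        have "box \<pi> ?us (c0 j, d0 j) = {}" using l j(4) by (rule bspec)
        then show False using j(1,2) unfolding bx[OF bd0] by blast
      qed
    next
      assume r: ?r
      show ?l
      proof
        fix x assume "x \<in> S"
        moreover obtain u v where x: "x = (u, v)" by (cases x)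
        ultimately have uv: "(u, v) \<in> S" "u \<le> ?m" "v \<le> ?m" using SS by auto
        show "box \<pi> ?us x = {}"
          unfolding x bx[OF uv(2,3)]
        proof (rule equals0I)
          fix j assume "j \<in> {j \<in> {1..n}. j \<notin> ?U \<and> c0 j = u \<and> d0 j = v}"
          then have j: "j \<in> {1..n}" "j \<notin> ?U" "c0 j = u" "d0 j = v" by auto
          show False
          proof (cases "j \<in> set M")
            case True
            then show False using M(3,4)[OF True] j uv(1) ab(3) by simp
          next
            case False
            then show False using r j uv(1) by blast
          qed
        qed
      qed
    qed
    show ?thesis unfolding ball_Un 1 2 3 cm_def dm_def ..
  qed
  define LB where "LB \<longleftrightarrow> (\<forall>x\<in>S1 \<union> S2. box \<pi> (A @ M @ B) x = {})"
  define BB where "BB \<longleftrightarrow> (\<forall>x\<in>S. box \<pi> ?us x = {})"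
  define CC where "CC \<longleftrightarrow> (\<forall>(r, s)\<in>R. \<forall>j\<in>box \<pi> ?us (a, b) - set M.
       \<not> (card {i \<in> set M. i < j} = r \<and> card {i \<in> set M. ?e i < ?e j} = s))"
  have L: "?L \<longleftrightarrow> shape \<and> LB"
    unfolding ieq occurrence_def fst_conv snd_conv P(1) LB_def[symmetric] shapeL[symmetric] conj_assoc ..
  have R: "?R \<longleftrightarrow> shape \<and> BB \<and> CC"
    unfolding occurrence_def fst_conv snd_conv P(1) BB_def[symmetric] CC_def[symmetric] shape_def
    by (simp only: conj_ac)
  have LBC: "LB \<longleftrightarrow> BB \<and> CC" if shape
    unfolding LB_def BB_def CC_def by (rule boxes[OF that])
  show ?thesis unfolding L R using LBC by blast
qed

lemma occurrence_standardize:
  assumes ins: "mesh_pattern (\<tau>, R)" and \<pi>: "\<pi> \<in> Perms n" and X: "X \<subseteq> {1..n}"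
    and bs: "bs = sorted_list_of_set X"
  shows "(\<exists>js. occurrence (\<tau>, R) (standardize (map (entry \<pi>) bs)) js \<and> M = map (entry bs) js) \<longleftrightarrow>
    sorted_wrt (<) M \<and> set M \<subseteq> X \<and> order_iso (map (entry \<pi>) M) \<tau> \<and>
    (\<forall>(r, s)\<in>R. \<forall>j\<in>X - set M.
       \<not> (card {i \<in> set M. i < j} = r \<and> card {i \<in> set M. entry \<pi> i < entry \<pi> j} = s))"
    (is "?L \<longleftrightarrow> ?R")
proof -
  note P = PermsD[OF \<pi>]
  let ?e = "entry \<pi>" and ?h = "entry bs" and ?k = "length \<tau>" and ?q = "length bs"
  have RR: "R \<subseteq> {0..?k} \<times> {0..?k}" using ins by (auto simp: mesh_pattern_def)
  have finX: "finite X" using X by (rule finite_subset) simp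
  then have sbs: "set bs = X" "sorted_wrt (<) bs" "distinct bs"
    by (simp_all add: bs strict_sorted_list_of_set)
  define \<rho> where "\<rho> = standardize (map ?e bs)"
  have db: "distinct (map ?e bs)"
    using sbs X P(4) by (auto simp: distinct_map intro: inj_on_subset)
  have \<rho>: "\<rho> \<in> Perms ?q" using standardize_Perms(1)[OF db] by (simp add: \<rho>_def)
  have \<rho>lt: "entry \<rho> i < entry \<rho> j \<longleftrightarrow> ?e (?h i) < ?e (?h j)" if "i \<in> {1..?q}" "j \<in> {1..?q}" for i j
  proof -
    have "i - 1 < ?q" "j - 1 < ?q" using that by auto
    then show ?thesis using standardize_Perms(2)[OF db, of "i - 1" "j - 1"]
      by (simp add: \<rho>_def entry_def)
  qed
  have hlt1: "?h i < ?h j" if "i \<in> {1..?q}" "j \<in> {1..?q}" "i < j" for i j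
    using that sbs(2) by (auto simp: entry_def sorted_wrt_iff_nth_less)
  have hlt: "?h i < ?h j \<longleftrightarrow> i < j" if "i \<in> {1..?q}" "j \<in> {1..?q}" for i j
    using hlt1[of i j] hlt1[of j i] that by (cases i j rule: linorder_cases) auto
  have hinj: "inj_on ?h {1..?q}"
  proof (rule inj_onI)
    fix i j assume "i \<in> {1..?q}" "j \<in> {1..?q}" "?h i = ?h j"
    then show "i = j" using hlt1[of i j] hlt1[of j i] by (cases i j rule: linorder_cases) auto
  qed
  have himg: "?h ` {1..?q} = X"
  proof -
    have "bs = map ?h [1..<Suc ?q]"
      by (rule nth_equalityI) (auto simp: entry_def simp del: upt_Suc)
    then have "set bs = set (map ?h [1..<Suc ?q])" by (rule arg_cong)
    then show ?thesis using sbs(1) by (simp add: atLeastLessThanSuc_atLeastAtMost del: upt_Suc)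
  qed
  have core: "occurrence (\<tau>, R) \<rho> js \<longleftrightarrow> sorted_wrt (<) M \<and> order_iso (map ?e M) \<tau> \<and>
    (\<forall>(r, s)\<in>R. \<forall>j\<in>X - set M.
       \<not> (card {i \<in> set M. i < j} = r \<and> card {i \<in> set M. ?e i < ?e j} = s))"
    if js: "set js \<subseteq> {1..?q}" and M: "M = map ?h js" for js
  proof -
    have s: "sorted_wrt (<) M \<longleftrightarrow> sorted_wrt (<) js"
    proof -
      have "js ! i \<in> {1..?q}" if "i < length js" for i using js that by (meson nth_mem subsetD)
      then show ?thesis unfolding M sorted_wrt_iff_nth_less by (auto simp: hlt)
    qed
    have o: "order_iso (map ?e M) \<tau> \<longleftrightarrow> order_iso (map (entry \<rho>) js) \<tau>"
      unfolding M map_map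
    proof (rule order_iso_map_cong)
      fix x y assume "x \<in> set js" "y \<in> set js"
      then have "x \<in> {1..?q}" "y \<in> {1..?q}" using js by blast+
      then show "(?e \<circ> ?h) x < (?e \<circ> ?h) y \<longleftrightarrow> entry \<rho> x < entry \<rho> y" by (simp only: \<rho>lt o_apply)
    qed
    have cc: "card {i \<in> set M. Q i} = card {i \<in> set js. Q (?h i)}" for Q
    proof -
      have "{i \<in> set M. Q i} = ?h ` {i \<in> set js. Q (?h i)}" by (auto simp: M)
      moreover have "inj_on ?h {i \<in> set js. Q (?h i)}"
        using hinj by (rule inj_on_subset) (use js in auto)
      ultimately show ?thesis by (simp add: card_image)
    qed
    have XM: "X - set M = ?h ` ({1..?q} - set js)"
      unfolding M set_map himg[symmetric] using hinj js
      by (simp add: inj_on_image_set_diff)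
    have b: "box \<rho> js (r, s) = {} \<longleftrightarrow> (\<forall>j\<in>X - set M.
       \<not> (card {i \<in> set M. i < j} = r \<and> card {i \<in> set M. ?e i < ?e j} = s))"
      if "(r, s) \<in> R" "sorted_wrt (<) js" "length js = ?k" for r s
    proof -
      have bxq: "box \<rho> js (r, s) = {j \<in> {1..?q}. j \<notin> set js \<and> card {i \<in> set js. i < j} = r \<and>
                              card {i \<in> set js. entry \<rho> i < entry \<rho> j} = s}"
        by (rule box_iff) (use \<rho> js that RR in auto)
      have e1: "{i \<in> set js. ?h i < ?h j} = {i \<in> set js. i < j}" if j: "j \<in> {1..?q}" for j
        using js hlt[OF _ j] by blast
      have e2: "{i \<in> set js. ?e (?h i) < ?e (?h j)} = {i \<in> set js. entry \<rho> i < entry \<rho> j}"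
        if j: "j \<in> {1..?q}" for j
        using js \<rho>lt[OF _ j] by blast
      have "(\<forall>j\<in>X - set M. \<not> (card {i \<in> set M. i < j} = r \<and>
            card {i \<in> set M. ?e i < ?e j} = s)) \<longleftrightarrow>
          (\<forall>j\<in>{1..?q} - set js. \<not> (card {i \<in> set js. i < j} = r \<and>
            card {i \<in> set js. entry \<rho> i < entry \<rho> j} = s))"
        unfolding XM ball_simps(9) cc
        by (intro ball_cong refl) (simp only: e1 e2 Diff_iff)
      then show ?thesis unfolding bxq by blast
    qed
    have bR: "(\<forall>x\<in>R. box \<rho> js x = {}) \<longleftrightarrow> (\<forall>(r, s)\<in>R. \<forall>j\<in>X - set M.
       \<not> (card {i \<in> set M. i < j} = r \<and> card {i \<in> set M. ?e i < ?e j} = s))"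
      if "sorted_wrt (<) js" "length js = ?k"
    proof (intro ball_cong refl)
      fix x assume x: "x \<in> R"
      obtain r s where rs: "x = (r, s)" by (cases x)
      show "box \<rho> js x = {} \<longleftrightarrow> (case x of (r, s) \<Rightarrow> \<forall>j\<in>X - set M.
       \<not> (card {i \<in> set M. i < j} = r \<and> card {i \<in> set M. ?e i < ?e j} = s))"
        using b[OF x[unfolded rs] that] by (simp only: rs prod.case)
    qed
    have "order_iso (map ?e M) \<tau> \<Longrightarrow> length js = ?k" by (simp add: order_iso_def M)
    then show ?thesis
      unfolding occurrence_def fst_conv snd_conv PermsD(1)[OF \<rho>] s o[symmetric]
      using js bR by blast
  qed
  show ?thesis
  proof
    assume ?L
    then obtain js where o: "occurrence (\<tau>, R) \<rho> js" and M: "M = map ?h js" unfolding \<rho>_def by blast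
    have js: "set js \<subseteq> {1..?q}" using o by (simp add: occurrence_def PermsD(1)[OF \<rho>])
    have "set M \<subseteq> X" using js himg M by auto
    then show ?R using core[OF js M] o by blast
  next
    assume r: ?R
    define js where "js = map (inv_into {1..?q} ?h) M"
    have MX: "x \<in> ?h ` {1..?q}" if "x \<in> set M" for x using r that himg by blast
    have js: "set js \<subseteq> {1..?q}" unfolding js_def using inv_into_into[OF MX] by auto
    have M: "M = map ?h js" unfolding js_def
      by (rule sym, subst map_map, rule map_idI) (simp only: o_apply f_inv_into_f[OF MX])
    show ?L using core[OF js M] r M unfolding \<rho>_def by blast
  qed
qed

lemma occurrence_insert_mesh:
  assumes base: "mesh_pattern (\<sigma>, S)" and ins: "mesh_pattern (\<tau>, R)"
    and ab: "a \<le> length \<sigma>" "b \<le> length \<sigma>" "(a, b) \<notin> S" and \<pi>: "\<pi> \<in> Perms n"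
  shows "occurrence (insert_mesh (\<sigma>, S) (a, b) (\<tau>, R)) \<pi> ps \<longleftrightarrow>
    (\<exists>us js. occurrence (\<sigma>, S) \<pi> us \<and>
       (let bs = sorted_list_of_set (box \<pi> us (a, b)) in
          occurrence (\<tau>, R) (standardize (map (entry \<pi>) bs)) js \<and>
          ps = take a us @ map (entry bs) js @ drop a us))"
    (is "?L \<longleftrightarrow> ?R")
proof -
  have X: "box \<pi> us (a, b) \<subseteq> {1..n}" for us
    using PermsD(1)[OF \<pi>] by (auto simp: box_def Let_def)
  have lo: "length us = length \<sigma>" if "occurrence (\<sigma>, S) \<pi> us" for us
    using that by (simp add: occurrence_def order_iso_def)
  note st = occurrence_standardize[OF ins \<pi> X refl]
  show ?thesis
  proof
    assume L: ?L
    define A where "A = take a ps"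
    define M where "M = take (length \<tau>) (drop a ps)"
    define B where "B = drop (length \<tau>) (drop a ps)"
    have ps: "ps = A @ M @ B" by (simp only: A_def M_def B_def append_take_drop_id)
    have "length ps = length \<sigma> + length \<tau>"
      using L ab(1) by (simp add: occurrence_def order_iso_def insert_mesh_def Let_def)
    then have len: "length A = a" "length (A @ B) = length \<sigma>" "length M = length \<tau>"
      using ab(1) by (auto simp: A_def M_def B_def)
    note L' = L[unfolded ps occurrence_split[OF base ins ab \<pi> len]]
    note 1 = conjunct1[OF L']
    from iffD2[OF st conjunct2[OF L']] obtain js where
      "occurrence (\<tau>, R) (standardize (map (entry \<pi>) (sorted_list_of_set (box \<pi> (A @ B) (a, b))))) js"
      "M = map (entry (sorted_list_of_set (box \<pi> (A @ B) (a, b)))) js"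
      by blast
    then show ?R using 1 ps len(1)
      by (intro exI[of _ "A @ B"] exI[of _ js]) (simp add: Let_def)
  next
    assume ?R
    then obtain us js where us: "occurrence (\<sigma>, S) \<pi> us"
      and js: "occurrence (\<tau>, R) (standardize (map (entry \<pi>) (sorted_list_of_set (box \<pi> us (a, b))))) js"
      and ps: "ps = take a us @ map (entry (sorted_list_of_set (box \<pi> us (a, b)))) js @ drop a us"
      by (auto simp: Let_def)
    define M where "M = map (entry (sorted_list_of_set (box \<pi> us (a, b)))) js"
    have len: "length (take a us) = a" "length (take a us @ drop a us) = length \<sigma>"
      "length M = length \<tau>"
      using lo[OF us] ab(1) js by (auto simp: M_def occurrence_def order_iso_def)
    show ?L unfolding ps M_def[symmetric] occurrence_split[OF base ins ab \<pi> len]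
      unfolding append_take_drop_id using us iffD1[OF st, OF exI, OF conjI[OF js M_def]] by (rule conjI)
  qed
qed

end

theory Submission
  imports Defs
begin

text \<open>
  Every box of the base pattern other than the central one is shaded, so in an occurrence
  \<open>\<pi>\<^sub>i < \<pi>\<^sub>j\<close> each remaining element of \<open>\<pi>\<close> lies to the right of \<open>i\<close> and to the left of \<open>j\<close>, above
  \<open>\<pi>\<^sub>i\<close> and below \<open>\<pi>\<^sub>j\<close>. Hence \<open>\<pi>\<close> has an occurrence only if it starts with its minimum and
  ends with its maximum, that is, if \<open>\<pi> = 1 (\<rho> + 1) n\<close> for some permutation \<open>\<rho>\<close> of size \<open>n - 2\<close>,
  and then the occurrence is unique (\<open>occurrence_frame_mesh\<close>, \<open>framed_perms\<close>). The elements in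
  the central box then form a copy of \<open>\<rho>\<close>, so that the occurrences of \<open>p\<close> in \<open>\<pi>\<close> are
  those of \<open>p\<^sub>1\<close> in \<open>\<rho>\<close> (\<open>occ_count_framed\<close>). All other permutations avoid \<open>p\<close>.

  Both identities are instances of one statement: give a permutation with \<open>k\<close>
  occurrences the weight \<open>g k\<close>, where \<open>g 0 = 1\<close>. The excess \<open>g k - 1\<close> vanishes outside
  the framed permutations, whence the excess of the weighted series over \<open>F(x)\<close> gets multiplied
  by \<open>x\<^sup>2\<close> when passing from \<open>p\<^sub>1\<close> to \<open>p\<close> (\<open>weighted_gf_insert\<close>). The weight \<open>q\<^sup>k\<close> gives the
  distribution and the weight \<open>[k = 0]\<close> the avoidance series.
\<close>

definition frame_mesh :: mesh where
  "frame_mesh = ([1, 2], {(0,0), (0,1), (0,2), (1,0), (1,2), (2,0), (2,1), (2,2)})"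

definition framed :: "nat list \<Rightarrow> nat list" where
  "framed \<rho> = 1 # map Suc \<rho> @ [length \<rho> + 2]"

lemma mesh_pattern_frame_mesh: "mesh_pattern frame_mesh"
  by (auto simp: mesh_pattern_def frame_mesh_def permutations_of_set_def)

lemma frame_mesh_shading:
  "u \<le> 2 \<Longrightarrow> v \<le> 2 \<Longrightarrow> (u, v) \<in> snd frame_mesh \<longleftrightarrow> (u, v) \<noteq> (1, 1)"
  by (auto simp: frame_mesh_def le_Suc_eq numeral_2_eq_2)

text \<open>
  The shading forces all elements outside the occurrence into the central box; since some element
  sits at each extreme position and some element takes each extreme value, the two
  elements of the occurrence must be the ones to do so.
\<close>

lemma occurrence_frame_mesh:
  assumes \<pi>: "\<pi> \<in> Perms n"
  shows "occurrence frame_mesh \<pi> us \<longleftrightarrow>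
           2 \<le> n \<and> us = [1, n] \<and> entry \<pi> 1 = 1 \<and> entry \<pi> n = n"
    (is "?L \<longleftrightarrow> ?R")
proof
  note P = PermsD[OF \<pi>]
  let ?e = "entry \<pi>"
  assume L: ?L
  then have "length us = 2"
    by (simp add: occurrence_def order_iso_def frame_mesh_def)
  then obtain i j where us: "us = [i, j]"
    by (auto simp: length_Suc_conv numeral_2_eq_2)
  have ij: "i < j" "i \<in> {1..n}" "j \<in> {1..n}" "?e i < ?e j"
    using L P(1) by (auto simp: us occurrence_def order_iso_def frame_mesh_def less_Suc_eq)
  have inner: "i < k \<and> k < j \<and> ?e i < ?e k \<and> ?e k < ?e j"
    if k: "k \<in> {1..n}" "k \<noteq> i" "k \<noteq> j" for k
  proof -
    let ?u = "card {x \<in> set us. x < k}" and ?v = "card {x \<in> set us. ?e x < ?e k}"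
    have le: "?u \<le> card (set us)" "?v \<le> card (set us)" by (auto intro!: card_mono)
    have c2: "card (set us) = 2" using ij(1) by (simp add: us)
    have "k \<in> box \<pi> us (?u, ?v)"
      using box_iff[OF \<pi>, of us ?u ?v] le c2 ij k by (auto simp: us)
    then have "(?u, ?v) \<notin> snd frame_mesh" using L by (auto simp: occurrence_def)
    then have uv: "?u = 1" "?v = 1" using le c2 frame_mesh_shading by auto
    (* Exactly one element of {i, j} is to the left of k, and exactly one is below it. *)
    have "{x \<in> set us. x < k} = (if i < k then {i} else {}) \<union> (if j < k then {j} else {})"
      "{x \<in> set us. ?e x < ?e k} = (if ?e i < ?e k then {i} else {}) \<union> (if ?e j < ?e k then {j} else {})"
      by (auto simp: us)
    then have "i < k" "\<not> j < k" "?e i < ?e k" "\<not> ?e j < ?e k"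
      using uv ij(1,4) by (auto split: if_splits)
    moreover have "?e k \<noteq> ?e j" using inj_onD[OF P(4)] k ij by blast
    ultimately show ?thesis using k by auto
  qed
  have n: "2 \<le> n" using ij by auto
  have i: "i = 1" using inner[of 1] ij n by force
  have j: "j = n" using inner[of n] ij n by force
  have "?e ` {1..n} = {1..n}" using P(4,5) by (intro endo_inj_surj) auto
  then have "1 \<in> ?e ` {1..n}" "n \<in> ?e ` {1..n}" using n by simp_all
  then obtain k l where kl: "k \<in> {1..n}" "?e k = 1" "l \<in> {1..n}" "?e l = n"
    by (metis imageE)
  have "k = i" using inner[OF kl(1)] kl(2) P(5)[OF ij(2)] ij(4) by force
  moreover have "l = j" using inner[OF kl(3)] kl(4) P(5)[OF ij(3)] ij(4) by force
  ultimately show ?R using us i j n kl by simp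
next
  assume R: ?R
  have "box \<pi> us b = {}" if "b \<in> snd frame_mesh" for b
    using that R PermsD(1)[OF \<pi>]
    by (auto simp: frame_mesh_def box_def grid_def Let_def numeral_2_eq_2)
  then show ?L using R PermsD(1)[OF \<pi>]
    by (auto simp: occurrence_def order_iso_def frame_mesh_def less_Suc_eq)
qed

lemma framed_in_Perms:
  assumes "\<rho> \<in> Perms m"
  shows "framed \<rho> \<in> Perms (m + 2)"
proof -
  note P = PermsD[OF assms]
  have "set (framed \<rho>) = {1..m + 2}"
  proof -
    have "set (framed \<rho>) = insert 1 (insert (m + 2) (Suc ` {1..m}))"
      using P(1,2) by (auto simp: framed_def)
    also have "\<dots> = {1..m + 2}" by (auto simp: image_Suc_atLeastAtMost)
    finally show ?thesis .
  qed
  moreover have "distinct (framed \<rho>)"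
    using P(1,2,3) by (auto simp: framed_def distinct_map)
  ultimately show ?thesis by (simp add: permutations_of_set_def)
qed

lemma inj_framed: "inj framed"
  by (auto simp: inj_def framed_def)

lemma framed_perms:
  "{\<pi> \<in> Perms (m + 2). entry \<pi> 1 = 1 \<and> entry \<pi> (m + 2) = m + 2} = framed ` Perms m"
proof (intro equalityI subsetI)
  fix \<pi> assume "\<pi> \<in> {\<pi> \<in> Perms (m + 2). entry \<pi> 1 = 1 \<and> entry \<pi> (m + 2) = m + 2}"
  then have \<pi>: "\<pi> \<in> Perms (m + 2)" and e: "entry \<pi> 1 = 1" "entry \<pi> (m + 2) = m + 2" by auto
  note P = PermsD[OF \<pi>]
  obtain x \<mu> y where xy: "\<pi> = x # \<mu> @ [y]"
    using P(1) by (metis Suc_length_conv add_2_eq_Suc' length_0_conv nat.distinct(1) rev_exhaust)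
  have len: "length \<mu> = m" using P(1) xy by simp
  have x: "x = 1" and y: "y = m + 2" using e len by (simp_all add: xy entry_def nth_append)
  have d: "distinct \<mu>" "1 \<notin> set \<mu>" "m + 2 \<notin> set \<mu>" using P(3) by (auto simp: xy x y)
  have "insert 1 (insert (m + 2) (set \<mu>)) = {1..m + 2}" using P(2) by (simp add: xy x y)
  then have "set \<mu> = {1..m + 2} - {1, m + 2}" using d(2,3) by blast
  also have "\<dots> = {Suc 1..Suc m}" by auto
  finally have s: "set \<mu> = Suc ` {1..m}" unfolding image_Suc_atLeastAtMost .
  define \<rho> where "\<rho> = map (\<lambda>v. v - 1) \<mu>"
  have \<mu>: "\<mu> = map Suc \<rho>"
    unfolding \<rho>_def map_map by (rule map_idI[symmetric]) (use s in auto)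
  have "Suc ` set \<rho> = Suc ` {1..m}" using s by (simp only: \<mu> set_map)
  then have "set \<rho> = {1..m}" by (simp only: inj_image_eq_iff inj_Suc)
  moreover have "distinct \<rho>" using d(1) by (simp add: \<mu> distinct_map)
  ultimately have "\<rho> \<in> Perms m" by (simp add: permutations_of_set_def)
  moreover have "\<pi> = framed \<rho>" using len by (simp add: framed_def xy x y \<mu>)
  ultimately show "\<pi> \<in> framed ` Perms m" by blast
next
  fix \<pi> assume "\<pi> \<in> framed ` Perms m"
  then obtain \<rho> where \<rho>: "\<rho> \<in> Perms m" "\<pi> = framed \<rho>" by blast
  then show "\<pi> \<in> {\<pi> \<in> Perms (m + 2). entry \<pi> 1 = 1 \<and> entry \<pi> (m + 2) = m + 2}"
    using framed_in_Perms[OF \<rho>(1)] PermsD(1)[OF \<rho>(1)] by (simp add: framed_def entry_def nth_append)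
qed

lemma standardize_map_Suc:
  assumes "\<rho> \<in> Perms m"
  shows "standardize (map Suc \<rho>) = \<rho>"
proof -
  have "card {u \<in> Suc ` {1..m}. u \<le> Suc v} = v" if "v \<in> {1..m}" for v
  proof -
    have "{u \<in> Suc ` {1..m}. u \<le> Suc v} = Suc ` {1..v}"
      using that by (auto simp: image_Suc_atLeastAtMost)
    then show ?thesis by (simp add: card_image)
  qed
  then show ?thesis
    using PermsD(2)[OF assms] by (auto simp: standardize_def intro!: map_idI)
qed

text \<open>
  For the unique occurrence of the base pattern, the central box is everything between the first
  and the last position, so an occurrence of the composite pattern in \<open>framed \<rho>\<close> is an occurrence of the
  inserted pattern in \<open>\<rho>\<close>, with positions shifted by one and both end positions added.
\<close>

lemma occ_count_framed:
  assumes p1: "mesh_pattern p1" and \<rho>: "\<rho> \<in> Perms m"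
  shows "occ_count (insert_mesh frame_mesh (1, 1) p1) (framed \<rho>) = occ_count p1 \<rho>"
proof -
  obtain \<tau> R where tr: "p1 = (\<tau>, R)" by (cases p1)
  let ?\<pi> = "framed \<rho>" and ?g = "\<lambda>js. 1 # map Suc js @ [m + 2]"
  let ?bs = "[2..<m + 2]"
  note P = PermsD[OF \<rho>]
  have \<pi>: "?\<pi> \<in> Perms (m + 2)" using \<rho> by (rule framed_in_Perms)
  have ends: "entry ?\<pi> 1 = 1" "entry ?\<pi> (m + 2) = m + 2"
    using framed_perms \<rho> by blast+
  have mid: "map (entry ?\<pi>) ?bs = map Suc \<rho>"
    using P(1) by (intro nth_equalityI) (auto simp: entry_def framed_def nth_append simp del: upt_Suc)
  have std: "standardize (map (entry ?\<pi>) ?bs) = \<rho>"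
    unfolding mid using \<rho> by (rule standardize_map_Suc)
  have "entry ?\<pi> j \<in> {2..<m + 2}" if "j \<in> {2..<m + 2}" for j
  proof -
    have "entry ?\<pi> j \<in> set (map (entry ?\<pi>) ?bs)" using that by (simp del: upt_Suc)
    then show ?thesis unfolding mid using P(2) by auto
  qed
  then have "box ?\<pi> [1, m + 2] (1, 1) = {2..<m + 2}"
    using ends PermsD(1)[OF \<pi>] by (fastforce simp: box_def grid_def Let_def)
  then have bs: "sorted_list_of_set (box ?\<pi> [1, m + 2] (1, 1)) = ?bs" by simp
  have shift: "map (entry ?bs) js = map Suc js" if "occurrence p1 \<rho> js" for js
    using that P(1) by (auto simp: occurrence_def entry_def simp del: upt_Suc)
  have "occurrence (insert_mesh frame_mesh (1, 1) p1) ?\<pi> ps \<longleftrightarrow>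
      (\<exists>us js. occurrence frame_mesh ?\<pi> us \<and>
       (let bs = sorted_list_of_set (box ?\<pi> us (1, 1)) in
          occurrence p1 (standardize (map (entry ?\<pi>) bs)) js \<and>
          ps = take 1 us @ map (entry bs) js @ drop 1 us))" for ps
    using mesh_pattern_frame_mesh p1 \<pi> unfolding tr frame_mesh_def
    by (intro occurrence_insert_mesh) auto
  then have "occurrence (insert_mesh frame_mesh (1, 1) p1) ?\<pi> ps \<longleftrightarrow>
      (\<exists>js. occurrence p1 \<rho> js \<and> ps = 1 # map (entry ?bs) js @ [m + 2])" for ps
    using ends bs std by (simp add: occurrence_frame_mesh[OF \<pi>] Let_def del: upt_Suc)
  then have "{ps. occurrence (insert_mesh frame_mesh (1, 1) p1) ?\<pi> ps} =
      (\<lambda>js. 1 # map (entry ?bs) js @ [m + 2]) ` {js. occurrence p1 \<rho> js}"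
    by blast
  also have "\<dots> = ?g ` {js. occurrence p1 \<rho> js}"
    by (intro image_cong refl) (simp only: shift mem_Collect_eq)
  finally have "{ps. occurrence (insert_mesh frame_mesh (1, 1) p1) ?\<pi> ps} =
      ?g ` {js. occurrence p1 \<rho> js}" .
  moreover have "inj ?g" by (auto simp: inj_def)
  ultimately show ?thesis
    unfolding occ_count_def by (simp add: card_image inj_on_subset)
qed

lemma occ_count_unframed:
  assumes p1: "mesh_pattern p1" and \<pi>: "\<pi> \<in> Perms n"
    and unframed: "\<not> (2 \<le> n \<and> entry \<pi> 1 = 1 \<and> entry \<pi> n = n)"
  shows "occ_count (insert_mesh frame_mesh (1, 1) p1) \<pi> = 0"
proof -
  obtain \<tau> R where tr: "p1 = (\<tau>, R)" by (cases p1)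
  have "\<not> occurrence (insert_mesh frame_mesh (1, 1) p1) \<pi> ps" for ps
  proof
    assume "occurrence (insert_mesh frame_mesh (1, 1) p1) \<pi> ps"
    then have "\<exists>us. occurrence frame_mesh \<pi> us"
      using occurrence_insert_mesh[of "fst frame_mesh" "snd frame_mesh" \<tau> R 1 1 \<pi> n ps]
        mesh_pattern_frame_mesh p1 \<pi>
      unfolding tr by (auto simp: frame_mesh_def)
    then show False using unframed by (auto simp: occurrence_frame_mesh[OF \<pi>])
  qed
  then show ?thesis by (simp add: occ_count_def)
qed

definition weighted_gf :: "(nat \<Rightarrow> 'a::comm_ring_1) \<Rightarrow> mesh \<Rightarrow> 'a fps" where
  "weighted_gf g p = Abs_fps (\<lambda>n. \<Sum>\<pi>\<in>Perms n. g (occ_count p \<pi>))"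

lemma weighted_gf_minus_gf_fact_nth:
  "fps_nth (weighted_gf g p - gf_fact) n = (\<Sum>\<pi>\<in>Perms n. g (occ_count p \<pi>) - 1)"
  by (simp add: weighted_gf_def gf_fact_def sum_subtractf)

text \<open>
  Because \<open>g 0 = 1\<close>, subtracting \<open>gf_fact\<close> removes every permutation that avoids the composite
  pattern. What is left runs over \<open>framed \<rho>\<close>, which weighs the same as \<open>\<rho>\<close> and is two longer.
\<close>

lemma weighted_gf_insert:
  assumes p1: "mesh_pattern p1" and g0: "g 0 = 1"
  shows "weighted_gf g (insert_mesh frame_mesh (1, 1) p1) - gf_fact =
           fps_X ^ 2 * (weighted_gf g p1 - gf_fact)"
proof (rule fps_ext)
  fix n
  let ?p = "insert_mesh frame_mesh (1, 1) p1"
  let ?h = "\<lambda>\<pi>. g (occ_count ?p \<pi>) - 1"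
  have "(\<Sum>\<pi>\<in>Perms n. ?h \<pi>) =
      (if n < 2 then 0 else \<Sum>\<rho>\<in>Perms (n - 2). g (occ_count p1 \<rho>) - 1)"
  proof (cases "n < 2")
    case True
    then show ?thesis using occ_count_unframed[OF p1] g0 by (auto intro!: sum.neutral)
  next
    case False
    then obtain m where n: "n = m + 2" by (metis add.commute le_Suc_ex not_le)
    have "(\<Sum>\<pi>\<in>Perms n. ?h \<pi>) = (\<Sum>\<pi>\<in>framed ` Perms m. ?h \<pi>)"
    proof (rule sum.mono_neutral_right)
      show "framed ` Perms m \<subseteq> Perms n" using framed_in_Perms n by blast
      show "\<forall>\<pi>\<in>Perms n - framed ` Perms m. ?h \<pi> = 0"
        unfolding framed_perms[symmetric] n
        using occ_count_unframed[OF p1, of _ "m + 2"] g0 by auto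
    qed simp
    also have "\<dots> = (\<Sum>\<rho>\<in>Perms m. ?h (framed \<rho>))"
      using inj_framed by (simp add: sum.reindex inj_on_subset)
    also have "\<dots> = (\<Sum>\<rho>\<in>Perms m. g (occ_count p1 \<rho>) - 1)"
      using occ_count_framed[OF p1] by (intro sum.cong) auto
    finally show ?thesis by (simp add: n)
  qed
  then show "fps_nth (weighted_gf g ?p - gf_fact) n =
      fps_nth (fps_X ^ 2 * (weighted_gf g p1 - gf_fact)) n"
    by (simp only: fps_X_power_mult_nth weighted_gf_minus_gf_fact_nth)
qed

lemma gf_dist_weighted: "gf_dist p = weighted_gf (monom 1) p"
  by (simp add: gf_dist_def weighted_gf_def)

lemma gf_avoid_weighted: "gf_avoid p = weighted_gf (\<lambda>k. of_bool (k = 0)) p"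
  by (simp add: gf_avoid_def weighted_gf_def sum.If_cases of_bool_def Int_def)

theorem theorem3p1:
  fixes p1 p :: mesh
  assumes "mesh_pattern p1"
    and "p = insert_mesh ([1, 2], {(0,0), (0,1), (0,2), (1,0), (1,2), (2,0), (2,1), (2,2)}) (1, 1) p1"
  shows "gf_avoid p = gf_fact - fps_X ^ 2 * (gf_fact - gf_avoid p1) \<and>
         gf_dist p = (1 - fps_X ^ 2) * gf_fact + fps_X ^ 2 * gf_dist p1"
proof -
  have p: "p = insert_mesh frame_mesh (1, 1) p1" using assms(2) by (simp add: frame_mesh_def)
  have "gf_avoid p - gf_fact = fps_X ^ 2 * (gf_avoid p1 - gf_fact)"
    unfolding gf_avoid_weighted p using assms(1) by (rule weighted_gf_insert) simp
  moreover have "gf_dist p - gf_fact = fps_X ^ 2 * (gf_dist p1 - gf_fact)"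
    unfolding gf_dist_weighted p using assms(1) by (rule weighted_gf_insert) simp
  ultimately show ?thesis by (simp add: algebra_simps)
qed

end
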